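(* Let $G$ be a topological rough group with rough identity element $e$ such that $G$ is open in $\overline{G}$ and $e\in G$, and let $\mathscr{B}$ be an open neighborhood base of $e$ in $G$. For each $g\in G$, put $$\mathscr{L}_g=\{(gU)\cap G: U\in\mathscr{B}\}\quad\text{and}\quad \mathscr{R}_g=\{(Ug)\cap G: U\in\mathscr{B}\}.$$ Then, for each $g\in G$, $\mathscr{L}_g$ and $\mathscr{R}_g$ are both neighborhood bases of $g$ in $G$.
   Context: An approximation space $(X,R)$ is a non-empty set $X$ with an equivalence relation $R$; for $A\subset X$ the upper approximation is $\overline{A}=\{x\in X:[x]_R\cap A\neq\emptyset\}$, where $[x]_R$ is the equivalence class of $x$. Let $X$ carry a binary operation, written $xy$; $gU=\{gu:u\in U\}$ and $Ug=\{ug:u\in U\}$. A subset $G\subset X$ is a rough group if: (1) $xy\in\overline{G}$ for all $x,y\in G$; (2) $(xy)z=x(yz)$ for all $x,y,z\in\overline{G}$; (3) there is $e\in\overline{G}$ (the rough identity element) with $ex=xe=x$ for all $x\in\overline{G}$; (4) for every $x\in G$ there is $y\in G$ with $xy=yx=e$ (written $y=x^{-1}$). A topological rough group is a rough group $G$ together with a topology $\tau$ on $\overline{G}$ such that, with $\tau_G$ the subspace topology on $G$, the multiplication $G\times G\to\overline{G}$, $(x,y)\mapsto xy$, is continuous (product topology of $\tau_G$ on $G\times G$, $\tau$ on $\overline{G}$) and the inverse mapping $G\to G$, $x\mapsto x^{-1}$, is continuous for $\tau_G$. *)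

theory Defs
  imports "HOL-Analysis.Analysis"
begin

locale approximation_space =
  fixes X :: "'a set" and R :: "('a \<times> 'a) set"
  assumes nonempty: "X \<noteq> {}"
    and equiv: "equiv X R"
begin

definition upper_approx :: "'a set \<Rightarrow> 'a set"
  where "upper_approx A = {x \<in> X. R `` {x} \<inter> A \<noteq> {}}"

lemma subset_upper_approx: "A \<subseteq> X \<Longrightarrow> A \<subseteq> upper_approx A"
  using equiv_class_self[OF equiv] unfolding upper_approx_def by blast

end

text \<open>
  The operation is total on the carrier \<open>X\<close> but need not be associative or unital there.
  The rough identity is a parameter, since the inverse axiom refers to it; it is uniquely
  determined by \<open>rough_id_mem\<close>, \<open>rough_id_left\<close> and \<open>rough_id_right\<close>.
\<close>

locale rough_group = approximation_space X R
  for X :: "'a set" and R :: "('a \<times> 'a) set" +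
  fixes mult :: "'a \<Rightarrow> 'a \<Rightarrow> 'a" (infixl "\<cdot>" 70)
    and G :: "'a set" and e :: 'a
  assumes mult_carrier: "\<lbrakk>x \<in> X; y \<in> X\<rbrakk> \<Longrightarrow> x \<cdot> y \<in> X"
    and subset_carrier: "G \<subseteq> X"
    and mult_upper: "\<lbrakk>x \<in> G; y \<in> G\<rbrakk> \<Longrightarrow> x \<cdot> y \<in> upper_approx G"
    and assoc: "\<lbrakk>x \<in> upper_approx G; y \<in> upper_approx G; z \<in> upper_approx G\<rbrakk>
                  \<Longrightarrow> (x \<cdot> y) \<cdot> z = x \<cdot> (y \<cdot> z)"
    and rough_id_mem: "e \<in> upper_approx G"
    and rough_id_left: "x \<in> upper_approx G \<Longrightarrow> e \<cdot> x = x"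
    and rough_id_right: "x \<in> upper_approx G \<Longrightarrow> x \<cdot> e = x"
    and inverse_ex: "x \<in> G \<Longrightarrow> \<exists>y\<in>G. x \<cdot> y = e \<and> y \<cdot> x = e"
begin

definition rough_inv :: "'a \<Rightarrow> 'a"
  where "rough_inv x = (THE y. y \<in> G \<and> x \<cdot> y = e \<and> y \<cdot> x = e)"

lemma inverse_ex1:
  assumes "x \<in> G"
  shows "\<exists>!y. y \<in> G \<and> x \<cdot> y = e \<and> y \<cdot> x = e"
proof -
  have sub: "G \<subseteq> upper_approx G"
    by (rule subset_upper_approx[OF subset_carrier])
  have "y = z"
    if "y \<in> G" "y \<cdot> x = e" "z \<in> G" "x \<cdot> z = e" for y z
  proof -
    have mem: "x \<in> upper_approx G" "y \<in> upper_approx G" "z \<in> upper_approx G"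
      using sub assms that by blast+
    have "y = y \<cdot> (x \<cdot> z)" by (simp only: that rough_id_right[OF mem(2)])
    also have "\<dots> = (y \<cdot> x) \<cdot> z" by (rule assoc[OF mem(2) mem(1) mem(3), symmetric])
    also have "\<dots> = z" by (simp only: that rough_id_left[OF mem(3)])
    finally show ?thesis .
  qed
  with inverse_ex[OF assms] show ?thesis by blast
qed

lemma rough_inv:
  assumes "x \<in> G"
  shows "rough_inv x \<in> G" "x \<cdot> rough_inv x = e" "rough_inv x \<cdot> x = e"
  using theI'[OF inverse_ex1[OF assms]] unfolding rough_inv_def by blast+

end

locale topological_rough_group = rough_group X R mult G e
  for X :: "'a set" and R :: "('a \<times> 'a) set"
    and mult :: "'a \<Rightarrow> 'a \<Rightarrow> 'a" (infixl "\<cdot>" 70)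
    and G :: "'a set" and e :: 'a +
  fixes T :: "'a topology"
  assumes topspace_eq: "topspace T = upper_approx G"
    and continuous_mult:
      "continuous_map (prod_topology (subtopology T G) (subtopology T G)) T (\<lambda>(x, y). x \<cdot> y)"
    and continuous_inv: "continuous_map (subtopology T G) (subtopology T G) rough_inv"

text \<open>
  Neighbourhoods need not be open. The library's \<open>neighbourhood_base_at x P\<close> does not require
  the sets satisfying \<open>P\<close> to be neighbourhoods of \<open>x\<close>, so it is not used here.
\<close>

definition nbhd_in :: "'a topology \<Rightarrow> 'a \<Rightarrow> 'a set \<Rightarrow> bool"
  where "nbhd_in T x N \<longleftrightarrow> N \<subseteq> topspace T \<and> (\<exists>U. openin T U \<and> x \<in> U \<and> U \<subseteq> N)"

definition nbhd_base_at :: "'a topology \<Rightarrow> 'a \<Rightarrow> 'a set set \<Rightarrow> bool"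
  where "nbhd_base_at T x \<B> \<longleftrightarrow>
    (\<forall>B\<in>\<B>. nbhd_in T x B) \<and> (\<forall>N. nbhd_in T x N \<longrightarrow> (\<exists>B\<in>\<B>. B \<subseteq> N))"

definition open_nbhd_base_at :: "'a topology \<Rightarrow> 'a \<Rightarrow> 'a set set \<Rightarrow> bool"
  where "open_nbhd_base_at T x \<B> \<longleftrightarrow> nbhd_base_at T x \<B> \<and> (\<forall>B\<in>\<B>. openin T B)"

end

theory Submission
  imports Defs
begin

text \<open>
  Left translation by \<open>g\<close> maps \<open>G\<close> continuously into the upper approximation, but not
  in general into \<open>G\<close>. Since \<open>G\<close> is open, open sets of \<open>G\<close> are open in the upper approximation,
  so their preimages under translation are open in \<open>G\<close>. The set \<open>gU \<inter> G\<close> contains the preimage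
  of \<open>U\<close> under translation by the inverse of \<open>g\<close>, and a member of the base contained in the
  preimage of \<open>V\<close> under translation by \<open>g\<close> is sent into \<open>V\<close>. Right translation is symmetric.
\<close>

text \<open>The left and right cases share this form: \<open>f\<close> plays translation by
  \<open>g\<close> and \<open>h\<close> translation by its inverse. Both take values in the whole
  space of \<open>T\<close>, so \<open>h y\<close> may lie outside \<open>G\<close>.\<close>

lemma nbhd_base_at_image_Int:
  assumes G: "openin T G" and "e \<in> G" "g \<in> G"
    and f: "continuous_map (subtopology T G) T f" "f e = g"
    and h: "continuous_map (subtopology T G) T h" "h g = e"
    and fh: "\<And>y. y \<in> G \<Longrightarrow> f (h y) = y"
    and base: "open_nbhd_base_at (subtopology T G) e \<B>"
  shows "nbhd_base_at (subtopology T G) g {f ` U \<inter> G | U. U \<in> \<B>}"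
proof -
  let ?S = "subtopology T G"
  have top: "topspace ?S = G"
    using openin_subset[OF G] by auto
  \<comment> \<open>Continuity into \<open>T\<close> only pulls back sets open in \<open>T\<close>;
    openness of \<open>G\<close> lifts \<open>U\<close> to such a set.\<close>
  have preimage: "openin ?S {y \<in> G. k y \<in> U}"
    if "continuous_map ?S T k" "openin ?S U" for k U
    using openin_continuous_map_preimage[OF that(1) openin_trans_full[OF that(2) G]]
    by (simp only: top)
  have "nbhd_in ?S g (f ` U \<inter> G)" if "U \<in> \<B>" for U
  proof -
    have U: "openin ?S U" "e \<in> U"
      using base that unfolding open_nbhd_base_at_def nbhd_base_at_def nbhd_in_def by auto
    \<comment> \<open>Each such \<open>y\<close> is the image under \<open>f\<close> of the point
      \<open>h y\<close> of \<open>U\<close>. This preimage is the open witness; it contains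
      \<open>g\<close> because \<open>h g = e\<close>.\<close>
    have "{y \<in> G. h y \<in> U} \<subseteq> f ` U \<inter> G"
      using fh by force
    with preimage[OF h(1) U(1)] U(2) \<open>g \<in> G\<close> h(2) show ?thesis
      unfolding nbhd_in_def top by blast
  qed
  moreover have "\<exists>U\<in>\<B>. f ` U \<inter> G \<subseteq> N" if N: "nbhd_in ?S g N" for N
  proof -
    obtain V where V: "openin ?S V" "g \<in> V" "V \<subseteq> N"
      using N unfolding nbhd_in_def by blast
    \<comment> \<open>Pulling \<open>V\<close> back along \<open>f\<close> moves the question from
      \<open>g\<close> to \<open>e\<close>, where the given base applies.\<close>
    have "nbhd_in ?S e {u \<in> G. f u \<in> V}"
      using preimage[OF f(1) V(1)] V(2) \<open>e \<in> G\<close> f(2) unfolding nbhd_in_def top by blast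
    then obtain U where "U \<in> \<B>" "U \<subseteq> {u \<in> G. f u \<in> V}"
      using base unfolding open_nbhd_base_at_def nbhd_base_at_def by blast
    with V(3) show ?thesis by blast
  qed
  ultimately show ?thesis
    unfolding nbhd_base_at_def by (simp add: Setcompr_eq_image)
qed

context topological_rough_group
begin

lemma G_subset_upper_approx: "G \<subseteq> upper_approx G"
  by (rule subset_upper_approx[OF subset_carrier])

lemma topspace_subtopology_G: "topspace (subtopology T G) = G"
  using G_subset_upper_approx topspace_eq by auto

text \<open>Translation is multiplication restricted to a slice of the product, and the embedding of
  the slice is continuous.\<close>

lemma continuous_map_left_translation:
  assumes "a \<in> G"
  shows "continuous_map (subtopology T G) T (\<lambda>y. a \<cdot> y)"
proof -
  have "continuous_map (subtopology T G) (prod_topology (subtopology T G) (subtopology T G))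
      (\<lambda>y. (a, y))"
    \<comment> \<open>The default rule would rewrite the topspace to an intersection; removing it
      lets the topspace simplify to \<open>G\<close>.\<close>
    using assms
    by (intro continuous_map_pairedI)
      (simp_all add: topspace_subtopology_G del: topspace_subtopology)
  from continuous_map_compose[OF this continuous_mult] show ?thesis
    by (simp add: o_def)
qed

lemma continuous_map_right_translation:
  assumes "a \<in> G"
  shows "continuous_map (subtopology T G) T (\<lambda>y. y \<cdot> a)"
proof -
  have "continuous_map (subtopology T G) (prod_topology (subtopology T G) (subtopology T G))
      (\<lambda>y. (y, a))"
    using assms
    by (intro continuous_map_pairedI)
      (simp_all add: topspace_subtopology_G del: topspace_subtopology)
  from continuous_map_compose[OF this continuous_mult] show ?thesis
    by (simp add: o_def)
qed

text \<open>The inner product may leave \<open>G\<close>, but reassociation only asks that the three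
  factors lie in the upper approximation, and all three are in \<open>G\<close>.\<close>

lemma mult_rough_inv_cancel_left:
  assumes "g \<in> G" "y \<in> G"
  shows "g \<cdot> (rough_inv g \<cdot> y) = y"
proof -
  have "g \<cdot> (rough_inv g \<cdot> y) = (g \<cdot> rough_inv g) \<cdot> y"
    using assms rough_inv(1) G_subset_upper_approx by (intro assoc[symmetric]) blast+
  also have "\<dots> = y"
    using assms G_subset_upper_approx by (simp add: rough_inv(2) rough_id_left subsetD)
  finally show ?thesis .
qed

lemma mult_rough_inv_cancel_right:
  assumes "g \<in> G" "y \<in> G"
  shows "(y \<cdot> rough_inv g) \<cdot> g = y"
proof -
  have "(y \<cdot> rough_inv g) \<cdot> g = y \<cdot> (rough_inv g \<cdot> g)"
    using assms rough_inv(1) G_subset_upper_approx by (intro assoc) blast+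
  also have "\<dots> = y"
    using assms G_subset_upper_approx by (simp add: rough_inv(3) rough_id_right subsetD)
  finally show ?thesis .
qed

lemma nbhd_base_at_translates:
  assumes "openin T G" "e \<in> G" "open_nbhd_base_at (subtopology T G) e \<B>" "g \<in> G"
  shows "nbhd_base_at (subtopology T G) g {(\<lambda>u. g \<cdot> u) ` U \<inter> G | U. U \<in> \<B>}"
    and "nbhd_base_at (subtopology T G) g {(\<lambda>u. u \<cdot> g) ` U \<inter> G | U. U \<in> \<B>}"
proof -
  have g: "g \<in> upper_approx G"
    using G_subset_upper_approx \<open>g \<in> G\<close> by blast
  note inv = rough_inv[OF \<open>g \<in> G\<close>]
  show "nbhd_base_at (subtopology T G) g {(\<lambda>u. g \<cdot> u) ` U \<inter> G | U. U \<in> \<B>}"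
  proof (rule nbhd_base_at_image_Int[where f = "\<lambda>u. g \<cdot> u" and h = "\<lambda>y. rough_inv g \<cdot> y",
        OF assms(1,2,4) _ _ _ _ _ assms(3)])
    show "continuous_map (subtopology T G) T (\<lambda>u. g \<cdot> u)"
      "continuous_map (subtopology T G) T (\<lambda>y. rough_inv g \<cdot> y)"
      by (fact continuous_map_left_translation[OF \<open>g \<in> G\<close>]
          continuous_map_left_translation[OF inv(1)])+
    show "g \<cdot> e = g" by (fact rough_id_right[OF g])
    show "rough_inv g \<cdot> g = e" by (fact inv(3))
    show "g \<cdot> (rough_inv g \<cdot> y) = y" if "y \<in> G" for y
      by (fact mult_rough_inv_cancel_left[OF \<open>g \<in> G\<close> that])
  qed
  show "nbhd_base_at (subtopology T G) g {(\<lambda>u. u \<cdot> g) ` U \<inter> G | U. U \<in> \<B>}"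
  \<comment> \<open>The mirror case exchanges the two identity laws and the two inverse
    laws.\<close>
  proof (rule nbhd_base_at_image_Int[where f = "\<lambda>u. u \<cdot> g" and h = "\<lambda>y. y \<cdot> rough_inv g",
        OF assms(1,2,4) _ _ _ _ _ assms(3)])
    show "continuous_map (subtopology T G) T (\<lambda>u. u \<cdot> g)"
      "continuous_map (subtopology T G) T (\<lambda>y. y \<cdot> rough_inv g)"
      by (fact continuous_map_right_translation[OF \<open>g \<in> G\<close>]
          continuous_map_right_translation[OF inv(1)])+
    show "e \<cdot> g = g" by (fact rough_id_left[OF g])
    show "g \<cdot> rough_inv g = e" by (fact inv(2))
    show "(y \<cdot> rough_inv g) \<cdot> g = y" if "y \<in> G" for y
      by (fact mult_rough_inv_cancel_right[OF \<open>g \<in> G\<close> that])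
  qed
qed

end

theorem proposition4p7:
  fixes X :: "'a set" and R :: "('a \<times> 'a) set" and mult :: "'a \<Rightarrow> 'a \<Rightarrow> 'a"
    and G :: "'a set" and e :: 'a and T :: "'a topology" and \<B> :: "'a set set"
  assumes "topological_rough_group X R mult G e T"
    and "openin T G"
    and "e \<in> G"
    and "open_nbhd_base_at (subtopology T G) e \<B>"
  shows "\<forall>g\<in>G. nbhd_base_at (subtopology T G) g {((\<lambda>u. mult g u) ` U) \<inter> G | U. U \<in> \<B>}
             \<and> nbhd_base_at (subtopology T G) g {((\<lambda>u. mult u g) ` U) \<inter> G | U. U \<in> \<B>}"
  using topological_rough_group.nbhd_base_at_translates[OF assms] by blast

end
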